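(* Let $\Gamma \subset \mathsf{Homeo}(M)$ be a non-elementary convergence group and let $\sigma\colon\Gamma\times M\to\mathbb{R}$ be an expanding $\kappa$-coarse-cocycle. Then there is a choice of magnitude $\|\cdot\|_\sigma$ such that: if $x \in \Lambda(\Gamma)$ and $\alpha \in \Gamma$, then $$\limsup_{\gamma \rightarrow x} \left| \sigma(\alpha,x)-(\|\alpha \gamma\|_\sigma-\|\gamma\|_\sigma) \right| \leq 2\kappa,$$ where the limsup is over $\gamma\in\Gamma$ converging to $x$ in $\Gamma\sqcup M$.
   Context: Convergence groups. $M$ is a compact metrizable space. A subgroup $\Gamma\subset\mathsf{Homeo}(M)$ is a (discrete) convergence group if for every sequence $\{\gamma_n\}$ of distinct elements of $\Gamma$ there are $x,y\in M$ and a subsequence $\{\gamma_{n_j}\}$ such that $\gamma_{n_j}|_{M\smallsetminus\{y\}}$ converges locally uniformly to the constant $x$. The limit set $\Lambda(\Gamma)$ is the set of $x\in M$ for which there are $y\in M$ and a sequence $\{\gamma_n\}\subset\Gamma$ with $\gamma_n|_{M\smallsetminus\{y\}}\to x$ locally uniformly. $\Gamma$ is non-elementary if $\#\Lambda(\Gamma)\ge 3$. An element $\gamma$ is loxodromic if it has two fixed points $\gamma^+\ne\gamma^-$ in $\Lambda(\Gamma)$ such that $\gamma^{\pm n}|_{M\smallsetminus\{\gamma^{\mp}\}}$ converges locally uniformly to $\gamma^{\pm}$ as $n\to+\infty$. Compatible metrics. $\Gamma\sqcup M$ carries a unique compact metrizable topology for which the inclusions of $\Gamma$ (discrete) and of $M$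 are embeddings and the natural action of $\Gamma$ (left multiplication on $\Gamma$) is a convergence group action. A compatible metric $\mathrm{d}$ is a metric on $\Gamma\sqcup M$ inducing this topology; fix one. Coarse-cocycles. For $\kappa\ge0$, $\sigma\colon\Gamma\times M\to\mathbb{R}$ is a $\kappa$-coarse-cocycle if (i) $\limsup_{x\to x_0}|\sigma(\gamma,x_0)-\sigma(\gamma,x)|\le\kappa$ for all $\gamma\in\Gamma$, $x_0\in M$, and (ii) $|\sigma(\gamma_1\gamma_2,x)-(\sigma(\gamma_1,\gamma_2x)+\sigma(\gamma_2,x))|\le\kappa$ for all $\gamma_1,\gamma_2\in\Gamma$, $x\in M$. It is proper if $\sigma(\gamma_n,\gamma_n^+)\to+\infty$ whenever $\{\gamma_n\}\subset\Gamma$ is a sequence of distinct loxodromic elements with $\liminf_n\mathrm{d}(\gamma_n^-,\gamma_n^+)>0$. A magnitude for $\sigma$ is a function $\gamma\mapsto\|\gamma\|_\sigma\in\mathbb{R}$ on $\Gamma$ such that for every $\epsilon>0$ there is $C>0$ with $\|\gamma\|_\sigma-C\le\sigma(\gamma,x)\le\|\gamma\|_\sigma+C$ whenever $x\in M$, $\gamma\in\Gamma$ and $\mathrm{d}(x,\gamma^{-1})>\epsilon$ (here $\gamma^{-1}$ is a point of $\Gamma\sqcup M$). $\sigma$ is expanding if it is proper and admits a magnitude. *)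

theory Defs
  imports "HOL-Analysis.Analysis"
begin

section \<open>Convergence groups\<close>

text \<open>
  The maps \<open>f n\<close>, restricted to \<open>X\<close> minus \<open>y\<close>, converge locally uniformly to the constant map
  \<open>x\<close>. Uniform convergence to a constant map is the same for all metrics inducing the topology near
  \<open>x\<close>: it says that every neighbourhood of \<open>x\<close> eventually contains the whole image. Hence no metric
  is needed. The set \<open>W\<close> is chosen before \<open>U\<close>, as locally uniform convergence demands.
\<close>

definition locally_uniformly_to_const ::
    "'a topology \<Rightarrow> (nat \<Rightarrow> 'a \<Rightarrow> 'a) \<Rightarrow> 'a \<Rightarrow> 'a \<Rightarrow> bool" where
  "locally_uniformly_to_const X f y x \<longleftrightarrow>
     x \<in> topspace X \<and> y \<in> topspace X \<and>
     (\<forall>z \<in> topspace X - {y}.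
        \<exists>W. openin (subtopology X (topspace X - {y})) W \<and> z \<in> W \<and>
          (\<forall>U. openin X U \<and> x \<in> U \<longrightarrow> (\<forall>\<^sub>F n in sequentially. f n ` W \<subseteq> U)))"

text \<open>
  Stated for an action \<open>act\<close> on an abstract space, because it is used both for the action of a group
  of homeomorphisms on \<open>M\<close> itself and for its action on the disjoint union of the group and \<open>M\<close>.
  The group axioms are not repeated here, since they are evident for both actions.
\<close>

definition convergence_action ::
    "'a topology \<Rightarrow> 'g set \<Rightarrow> ('g \<Rightarrow> 'a \<Rightarrow> 'a) \<Rightarrow> bool" where
  "convergence_action X \<Gamma> act \<longleftrightarrow>
     (\<forall>\<gamma>\<in>\<Gamma>. homeomorphic_map X X (act \<gamma>)) \<and>
     (\<forall>g :: nat \<Rightarrow> 'g. range g \<subseteq> \<Gamma> \<and> inj g \<longrightarrow>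
        (\<exists>x y r. strict_mono r \<and> locally_uniformly_to_const X (\<lambda>n. act (g (r n))) y x))"

definition homeo_subgroup :: "('m::topological_space \<Rightarrow> 'm) set \<Rightarrow> bool" where
  "homeo_subgroup \<Gamma> \<longleftrightarrow>
     (\<forall>\<gamma>\<in>\<Gamma>. homeomorphic_map euclidean euclidean \<gamma>) \<and>
     id \<in> \<Gamma> \<and> (\<forall>\<alpha>\<in>\<Gamma>. \<forall>\<beta>\<in>\<Gamma>. \<alpha> \<circ> \<beta> \<in> \<Gamma>) \<and> (\<forall>\<gamma>\<in>\<Gamma>. inv \<gamma> \<in> \<Gamma>)"

definition convergence_group :: "('m::topological_space \<Rightarrow> 'm) set \<Rightarrow> bool" where
  "convergence_group \<Gamma> \<longleftrightarrow> homeo_subgroup \<Gamma> \<and> convergence_action euclidean \<Gamma> (\<lambda>\<gamma>. \<gamma>)"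

definition limit_set :: "('m::topological_space \<Rightarrow> 'm) set \<Rightarrow> 'm set" where
  "limit_set \<Gamma> =
     {x. \<exists>y g. range g \<subseteq> \<Gamma> \<and> locally_uniformly_to_const euclidean g y x}"

text \<open>The first disjunct is needed because \<open>card\<close> is zero on infinite sets.\<close>

definition non_elementary :: "('m::topological_space \<Rightarrow> 'm) set \<Rightarrow> bool" where
  "non_elementary \<Gamma> \<longleftrightarrow> infinite (limit_set \<Gamma>) \<or> card (limit_set \<Gamma>) \<ge> 3"

text \<open>
  \<open>\<gamma>\<close> is loxodromic with attracting fixed point \<open>p\<close> and repelling fixed point \<open>q\<close>. The fixed points
  are arguments rather than being selected by a choice operator.
\<close>

definition loxodromic_with ::
    "('m::topological_space \<Rightarrow> 'm) set \<Rightarrow> ('m \<Rightarrow> 'm) \<Rightarrow> 'm \<Rightarrow> 'm \<Rightarrow> bool" where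
  "loxodromic_with \<Gamma> \<gamma> p q \<longleftrightarrow>
     \<gamma> \<in> \<Gamma> \<and> p \<in> limit_set \<Gamma> \<and> q \<in> limit_set \<Gamma> \<and> p \<noteq> q \<and> \<gamma> p = p \<and> \<gamma> q = q \<and>
     locally_uniformly_to_const euclidean (\<lambda>n. \<gamma> ^^ n) q p \<and>
     locally_uniformly_to_const euclidean (\<lambda>n. inv \<gamma> ^^ n) p q"

section \<open>The compactification of a convergence group\<close>

text \<open>
  The disjoint union of \<open>\<Gamma>\<close> and \<open>M\<close> is \<open>\<Gamma> <+> UNIV\<close>, with \<open>Inl\<close> and \<open>Inr\<close> as the inclusions; an
  element of \<open>\<Gamma>\<close> acts by left multiplication on the first summand and tautologically on the second.
\<close>

definition compactification_action :: "('m \<Rightarrow> 'm) \<Rightarrow> ('m \<Rightarrow> 'm) + 'm \<Rightarrow> ('m \<Rightarrow> 'm) + 'm" where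
  "compactification_action \<gamma> = map_sum (\<lambda>g. \<gamma> \<circ> g) \<gamma>"

definition compactification_topology ::
    "('m::topological_space \<Rightarrow> 'm) set \<Rightarrow> (('m \<Rightarrow> 'm) + 'm) topology \<Rightarrow> bool" where
  "compactification_topology \<Gamma> T \<longleftrightarrow>
     topspace T = \<Gamma> <+> UNIV \<and> compact_space T \<and> metrizable_space T \<and>
     embedding_map (discrete_topology \<Gamma>) T Inl \<and> embedding_map euclidean T Inr \<and>
     convergence_action T \<Gamma> compactification_action"

definition compatible_metric ::
    "('m::topological_space \<Rightarrow> 'm) set \<Rightarrow> (('m \<Rightarrow> 'm) + 'm) topology \<Rightarrow>
     (('m \<Rightarrow> 'm) + 'm \<Rightarrow> ('m \<Rightarrow> 'm) + 'm \<Rightarrow> real) \<Rightarrow> bool" where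
  "compatible_metric \<Gamma> T d \<longleftrightarrow>
     Metric_space (\<Gamma> <+> UNIV) d \<and> Metric_space.mtopology (\<Gamma> <+> UNIV) d = T"

section \<open>Coarse-cocycles\<close>

text \<open>
  The limits superior are taken in \<open>ereal\<close>, since \<open>real\<close> is not a complete lattice. The filter
  \<open>at x0\<close> omits the point \<open>x0\<close> itself, where the difference vanishes anyway.
\<close>

definition coarse_cocycle ::
    "real \<Rightarrow> ('m::topological_space \<Rightarrow> 'm) set \<Rightarrow> (('m \<Rightarrow> 'm) \<Rightarrow> 'm \<Rightarrow> real) \<Rightarrow> bool" where
  "coarse_cocycle \<kappa> \<Gamma> \<sigma> \<longleftrightarrow>
     \<kappa> \<ge> 0 \<and>
     (\<forall>\<gamma>\<in>\<Gamma>. \<forall>x0. Limsup (at x0) (\<lambda>x. ereal \<bar>\<sigma> \<gamma> x0 - \<sigma> \<gamma> x\<bar>) \<le> ereal \<kappa>) \<and>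
     (\<forall>\<gamma>1\<in>\<Gamma>. \<forall>\<gamma>2\<in>\<Gamma>. \<forall>x. \<bar>\<sigma> (\<gamma>1 \<circ> \<gamma>2) x - (\<sigma> \<gamma>1 (\<gamma>2 x) + \<sigma> \<gamma>2 x)\<bar> \<le> \<kappa>)"

definition proper_cocycle ::
    "('m::topological_space \<Rightarrow> 'm) set \<Rightarrow> (('m \<Rightarrow> 'm) + 'm \<Rightarrow> ('m \<Rightarrow> 'm) + 'm \<Rightarrow> real) \<Rightarrow>
     (('m \<Rightarrow> 'm) \<Rightarrow> 'm \<Rightarrow> real) \<Rightarrow> bool" where
  "proper_cocycle \<Gamma> d \<sigma> \<longleftrightarrow>
     (\<forall>(g :: nat \<Rightarrow> 'm \<Rightarrow> 'm) p q.
        inj g \<and> (\<forall>n. loxodromic_with \<Gamma> (g n) (p n) (q n)) \<and>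
        liminf (\<lambda>n. ereal (d (Inr (q n)) (Inr (p n)))) > 0 \<longrightarrow>
        filterlim (\<lambda>n. \<sigma> (g n) (p n)) at_top sequentially)"

definition is_magnitude ::
    "('m \<Rightarrow> 'm) set \<Rightarrow> (('m \<Rightarrow> 'm) + 'm \<Rightarrow> ('m \<Rightarrow> 'm) + 'm \<Rightarrow> real) \<Rightarrow>
     (('m \<Rightarrow> 'm) \<Rightarrow> 'm \<Rightarrow> real) \<Rightarrow> (('m \<Rightarrow> 'm) \<Rightarrow> real) \<Rightarrow> bool" where
  "is_magnitude \<Gamma> d \<sigma> mag \<longleftrightarrow>
     (\<forall>\<epsilon>>0. \<exists>C>0. \<forall>x. \<forall>\<gamma>\<in>\<Gamma>. d (Inr x) (Inl (inv \<gamma>)) > \<epsilon> \<longrightarrow>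
        mag \<gamma> - C \<le> \<sigma> \<gamma> x \<and> \<sigma> \<gamma> x \<le> mag \<gamma> + C)"

definition expanding ::
    "('m::topological_space \<Rightarrow> 'm) set \<Rightarrow> (('m \<Rightarrow> 'm) + 'm \<Rightarrow> ('m \<Rightarrow> 'm) + 'm \<Rightarrow> real) \<Rightarrow>
     (('m \<Rightarrow> 'm) \<Rightarrow> 'm \<Rightarrow> real) \<Rightarrow> bool" where
  "expanding \<Gamma> d \<sigma> \<longleftrightarrow> proper_cocycle \<Gamma> d \<sigma> \<and> (\<exists>mag. is_magnitude \<Gamma> d \<sigma> mag)"

text \<open>
  The filter of group elements \<open>\<gamma>\<close> converging to the point \<open>x\<close> of \<open>M\<close> in \<open>T\<close>. Only elements of
  \<open>\<Gamma>\<close> matter, because \<open>topspace T = \<Gamma> <+> UNIV\<close> is itself a neighbourhood of \<open>x\<close>.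
\<close>

definition group_elements_tending_to ::
    "(('m \<Rightarrow> 'm) + 'm) topology \<Rightarrow> 'm \<Rightarrow> ('m \<Rightarrow> 'm) filter" where
  "group_elements_tending_to T x = filtercomap Inl (nhdsin T (Inr x))"

end

theory Submission
  imports Defs
begin

text \<open>
  Fix distinct points \<open>z1\<close>, \<open>z2\<close> of \<open>M\<close> and a Lipschitz function \<open>\<phi>\<close> on the compactification, with
  values in \<open>[0, 1]\<close>, vanishing near \<open>z1\<close> and equal to \<open>1\<close> near \<open>z2\<close>. The magnitude is the
  interpolation \<open>\<phi> (\<gamma>\<inverse>) \<sigma> (\<gamma>, z1) + (1 - \<phi> (\<gamma>\<inverse>)) \<sigma> (\<gamma>, z2)\<close>, in which \<open>zi\<close> only counts when it is
  far from \<open>\<gamma>\<inverse>\<close>. As \<open>\<gamma> \<rightarrow> x\<close>, the distance between \<open>\<gamma>\<inverse>\<close> and \<open>(\<alpha>\<gamma>)\<inverse>\<close> tends to \<open>0\<close>, so changing the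
  weights costs nothing in the limit, while \<open>\<sigma> (\<alpha>\<gamma>, zi) - \<sigma> (\<gamma>, zi)\<close> is \<open>\<kappa>\<close>-close to \<open>\<sigma> (\<alpha>, \<gamma> zi)\<close>,
  which is asymptotically \<open>\<kappa>\<close>-close to \<open>\<sigma> (\<alpha>, x)\<close> because \<open>\<gamma> zi \<rightarrow> x\<close>.
\<close>

text \<open>Finitely many of the sets on which the convergence is uniform cover \<open>K\<close>.
  The lemma serves for singletons, for the copy of \<open>M\<close>, and for the complement of a
  neighbourhood of the repelling point.\<close>

lemma locally_uniformly_to_const_compactin:
  assumes lu: "locally_uniformly_to_const X f y x"
    and K: "compactin X K" "y \<notin> K" and U: "openin X U" "x \<in> U"
  shows "\<forall>\<^sub>F n in sequentially. f n ` K \<subseteq> U"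
proof -
  let ?Y = "subtopology X (topspace X - {y})"
  have KY: "K \<subseteq> topspace X - {y}"
    using K compactin_subset_topspace by blast
  then have cK: "compactin ?Y K"
    using K by (simp add: compactin_subtopology)
  have "\<forall>z\<in>K. \<exists>W. openin ?Y W \<and> z \<in> W \<and> (\<forall>\<^sub>F n in sequentially. f n ` W \<subseteq> U)"
    using lu U KY unfolding locally_uniformly_to_const_def by blast
  then obtain W where W: "\<And>z. z \<in> K \<Longrightarrow> openin ?Y (W z) \<and> z \<in> W z \<and>
      (\<forall>\<^sub>F n in sequentially. f n ` W z \<subseteq> U)"
    by metis
  have "\<exists>\<F>. finite \<F> \<and> \<F> \<subseteq> W ` K \<and> K \<subseteq> \<Union>\<F>"
    using cK W unfolding compactin_def by (smt (verit) UN_iff image_iff subsetI)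
  then obtain F where F: "finite F" "F \<subseteq> K" "K \<subseteq> (\<Union>z\<in>F. W z)"
    by (metis finite_subset_image)
  have "\<forall>\<^sub>F n in sequentially. \<forall>z\<in>F. f n ` W z \<subseteq> U"
    using F W by (intro eventually_ball_finite) auto
  then show ?thesis
    by (rule eventually_mono) (use F in blast)
qed

section \<open>The compactification with a compatible metric and two base points\<close>

locale group_compactification = Metric_space "\<Gamma> <+> UNIV" d
  for \<Gamma> :: "('m::topological_space \<Rightarrow> 'm) set"
    and d :: "('m \<Rightarrow> 'm) + 'm \<Rightarrow> ('m \<Rightarrow> 'm) + 'm \<Rightarrow> real" +
  fixes z1 z2 :: 'm
  assumes homeo: "homeo_subgroup \<Gamma>"
    and compactification: "compactification_topology \<Gamma> mtopology"
    and compact_UNIV: "compact (UNIV :: 'm set)"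
    and z1_neq_z2: "z1 \<noteq> z2"
begin

lemma in_union_iff [simp]: "Inl \<gamma> \<in> \<Gamma> <+> UNIV \<longleftrightarrow> \<gamma> \<in> \<Gamma>" "Inr z \<in> \<Gamma> <+> UNIV"
  by auto

lemma id_mem: "id \<in> \<Gamma>"
  and comp_mem: "\<alpha> \<in> \<Gamma> \<Longrightarrow> \<beta> \<in> \<Gamma> \<Longrightarrow> \<alpha> \<circ> \<beta> \<in> \<Gamma>"
  and inv_mem: "\<alpha> \<in> \<Gamma> \<Longrightarrow> inv \<alpha> \<in> \<Gamma>"
  using homeo unfolding homeo_subgroup_def by auto

lemma bij_mem:
  assumes "\<gamma> \<in> \<Gamma>" shows "bij \<gamma>"
proof -
  have "homeomorphic_map euclidean euclidean \<gamma>"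
    using homeo assms by (simp add: homeo_subgroup_def)
  then have "inj_on \<gamma> UNIV" "\<gamma> ` UNIV = UNIV"
    using homeomorphic_imp_injective_map homeomorphic_imp_surjective_map by fastforce+
  then show ?thesis by (simp add: bij_def)
qed

lemma inv_comp: "\<alpha> \<in> \<Gamma> \<Longrightarrow> \<gamma> \<in> \<Gamma> \<Longrightarrow> inv (\<alpha> \<circ> \<gamma>) = inv \<gamma> \<circ> inv \<alpha>"
  by (simp add: bij_mem o_inv_distrib)

lemma openin_delete: "openin mtopology (topspace mtopology - {a})"
  by (metis Diff_empty Diff_insert0 Hausdorff_imp_t1_space Hausdorff_space_mtopology
      openin_topspace t1_space_openin_delete)

text \<open>\<open>Inr\<close> is an embedding, so \<open>V\<close> is the trace of an open set of
  the compactification. This carries attraction in the compactification back to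
  \<open>M\<close>.\<close>

lemma Inr_nhd:
  assumes "open V" "x \<in> V"
  obtains U where "openin mtopology U" "Inr x \<in> U" "\<And>z. Inr z \<in> U \<Longrightarrow> z \<in> V"
proof -
  have "embedding_map euclidean mtopology (Inr :: 'm \<Rightarrow> ('m \<Rightarrow> 'm) + 'm)"
    using compactification by (simp add: compactification_topology_def)
  then have "open_map euclidean (subtopology mtopology (range Inr)) (Inr :: 'm \<Rightarrow> ('m \<Rightarrow> 'm) + 'm)"
    by (simp add: embedding_map_def homeomorphic_imp_open_map)
  then have "openin (subtopology mtopology (range Inr)) (Inr ` V)"
    using assms by (simp add: open_map_def)
  then obtain U where "openin mtopology U" "Inr ` V = U \<inter> range Inr"
    by (auto simp: openin_subtopology)
  then show ?thesis
    using that assms by (metis IntD1 IntI image_eqI inj_image_mem_iff inj_Inr rangeI)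
qed

text \<open>
  The repelling point lies in \<open>M\<close>: otherwise all of \<open>M\<close>, which the group preserves, would be
  contracted to a point. Preimages of a fixed group element then accumulate only there, since away
  from the repelling point everything is pushed towards \<open>x\<close>.
\<close>

lemma convergence_subsequence:
  assumes g: "range g \<subseteq> \<Gamma>" "inj g"
    and lim: "limitin mtopology (\<lambda>n. Inl (g n)) (Inr x) sequentially"
  obtains r y where "strict_mono (r :: nat \<Rightarrow> nat)"
    "locally_uniformly_to_const mtopology (\<lambda>n. compactification_action (g (r n))) (Inr y) (Inr x)"
    "\<And>\<beta>. \<beta> \<in> \<Gamma> \<Longrightarrow> limitin mtopology (\<lambda>n. Inl (inv (g (r n)) \<circ> \<beta>)) (Inr y) sequentially"
proof -
  have "convergence_action mtopology \<Gamma> compactification_action"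
    using compactification by (simp add: compactification_topology_def)
  then obtain a b r where r: "strict_mono (r :: nat \<Rightarrow> nat)"
    and lu: "locally_uniformly_to_const mtopology (\<lambda>n. compactification_action (g (r n))) b a"
    using g unfolding convergence_action_def by metis
  have gr: "g (r n) \<in> \<Gamma>" for n using g by auto
  have ab: "a \<in> topspace mtopology" "b \<in> topspace mtopology"
    using lu by (auto simp: locally_uniformly_to_const_def)
  have "b \<in> range Inr"
  proof (rule ccontr)
    assume b: "b \<notin> range Inr"
    \<comment> \<open>One of \<open>z1\<close>, \<open>z2\<close> differs from \<open>a\<close>.
      Removing it leaves a neighbourhood of \<open>a\<close> that cannot contain the image of
      \<open>M\<close>, because group elements map \<open>M\<close> onto itself.\<close>
    obtain z where z: "Inr z \<noteq> a"
      using z1_neq_z2 by (metis Inr_inject)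
    have "embedding_map euclidean mtopology (Inr :: 'm \<Rightarrow> ('m \<Rightarrow> 'm) + 'm)"
      and "compactin euclidean (UNIV :: 'm set)"
      using compactification compact_UNIV by (simp_all add: compactification_topology_def)
    then have "compactin mtopology (range Inr)"
      by (meson continuous_map_in_subtopology embedding_map_def homeomorphic_imp_continuous_map image_compactin)
    then have "\<forall>\<^sub>F n in sequentially.
        compactification_action (g (r n)) ` range Inr \<subseteq> topspace mtopology - {Inr z}"
      using b z ab by (intro locally_uniformly_to_const_compactin[OF lu] openin_delete) auto
    then obtain n where n: "compactification_action (g (r n)) ` range Inr \<subseteq> - {Inr z}"
      by (fastforce dest!: eventually_happens)
    have "compactification_action (g (r n)) (Inr (inv (g (r n)) z)) = Inr z"
      using bij_mem[OF gr] by (simp add: compactification_action_def bij_inv_eq_iff surj_f_inv_f bij_is_surj)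
    then show False using n by (metis ComplD image_subset_iff rangeI singletonI)
  qed
  then obtain y where y: "b = Inr y" by blast
  \<comment> \<open>Evaluating the maps at the group element \<open>id\<close>, which differs from
    the repelling point, gives the limit of the elements themselves; uniqueness of limits then
    identifies \<open>a\<close>.\<close>
  have "limitin mtopology (\<lambda>n. Inl (g (r n))) a sequentially"
    unfolding limitin_def
  proof (intro conjI allI impI)
    fix U assume U: "openin mtopology U \<and> a \<in> U"
    have "\<forall>\<^sub>F n in sequentially. compactification_action (g (r n)) ` {Inl id} \<subseteq> U"
      using U y id_mem by (intro locally_uniformly_to_const_compactin[OF lu]) auto
    then show "\<forall>\<^sub>F n in sequentially. Inl (g (r n)) \<in> U"
      by (simp add: compactification_action_def)
  qed (use ab in auto)
  moreover have "limitin mtopology (\<lambda>n. Inl (g (r n))) (Inr x) sequentially"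
    using limitin_subsequence[OF r lim] by (simp add: o_def)
  ultimately have a: "a = Inr x"
    using limitin_metric_unique trivial_limit_sequentially by blast
  have "limitin mtopology (\<lambda>n. Inl (inv (g (r n)) \<circ> \<beta>)) (Inr y) sequentially" if \<beta>: "\<beta> \<in> \<Gamma>" for \<beta>
    unfolding limitin_def
  proof (intro conjI allI impI)
    fix U assume U: "openin mtopology U \<and> Inr y \<in> U"
    have "compact_space mtopology"
      using compactification by (simp add: compactification_topology_def)
    \<comment> \<open>This compact set avoids the repelling point, so its images eventually miss
      \<open>Inl \<beta>\<close>; the preimage of \<open>Inl \<beta>\<close> must therefore lie in
      \<open>U\<close>.\<close>
    then have "compactin mtopology (topspace mtopology - U)"
      using U by (meson closedin_compact_space closedin_topspace openin_closedin_eq closedin_diff)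
    then have "\<forall>\<^sub>F n in sequentially. compactification_action (g (r n)) ` (topspace mtopology - U)
        \<subseteq> topspace mtopology - {Inl \<beta>}"
      using U a y by (intro locally_uniformly_to_const_compactin[OF lu] openin_delete) auto
    then show "\<forall>\<^sub>F n in sequentially. Inl (inv (g (r n)) \<circ> \<beta>) \<in> U"
    proof (rule eventually_mono)
      fix n
      assume *: "compactification_action (g (r n)) ` (topspace mtopology - U)
        \<subseteq> topspace mtopology - {Inl \<beta>}"
      have "compactification_action (g (r n)) (Inl (inv (g (r n)) \<circ> \<beta>)) = Inl \<beta>"
        using bij_mem[OF gr] by (simp add: compactification_action_def fun_eq_iff surj_f_inv_f bij_is_surj)
      moreover have "Inl (inv (g (r n)) \<circ> \<beta>) \<in> topspace mtopology"
        using \<beta> gr comp_mem inv_mem by simp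
      ultimately show "Inl (inv (g (r n)) \<circ> \<beta>) \<in> U"
        using * by (auto simp: image_subset_iff)
    qed
  qed simp
  with r lu a y that show ?thesis by blast
qed

section \<open>Group elements tending to a point of \<open>M\<close>\<close>

text \<open>The convergence property concerns sequences of distinct elements. This lemma makes it
  available for claims along the filter, which are then proved by contradiction.\<close>

lemma not_eventually_tending_to_obtains_seq:
  assumes "\<not> eventually P (group_elements_tending_to mtopology x)"
  obtains g where "range g \<subseteq> \<Gamma>" "inj g" "\<And>n :: nat. \<not> P (g n)"
    "limitin mtopology (\<lambda>n. Inl (g n)) (Inr x) sequentially"
proof -
  have ex: "\<exists>\<gamma>. \<gamma> \<in> \<Gamma> \<and> \<not> P \<gamma> \<and> d (Inr x) (Inl \<gamma>) < e" if e: "e > 0" for e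
  proof (rule ccontr)
    assume "\<not> ?thesis"
    then have "\<forall>v\<in>mball (Inr x) e. \<forall>\<gamma>. Inl \<gamma> = v \<longrightarrow> P \<gamma>" by auto
    then have "\<forall>\<^sub>F v in nhdsin mtopology (Inr x). \<forall>\<gamma>. Inl \<gamma> = v \<longrightarrow> P \<gamma>"
      using e by (auto simp: eventually_nhdsin intro!: exI[of _ "mball (Inr x) e"])
    then have "eventually P (group_elements_tending_to mtopology x)"
      unfolding group_elements_tending_to_def eventually_filtercomap by blast
    with assms show False by simp
  qed
  have "\<exists>g. \<forall>n. (g n \<in> \<Gamma> \<and> \<not> P (g n) \<and> d (Inr x) (Inl (g n)) < inverse (real (Suc n))) \<and>
      d (Inr x) (Inl (g (Suc n))) < d (Inr x) (Inl (g n))"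
  proof (rule dependent_nat_choice)
    fix \<gamma> n assume "\<gamma> \<in> \<Gamma> \<and> \<not> P \<gamma> \<and> d (Inr x) (Inl \<gamma>) < inverse (real (Suc n))"
    \<comment> \<open>The first term makes the distances strictly decrease, hence the sequence
      injective; it is positive since \<open>Inl \<gamma>\<close> and \<open>Inr x\<close> lie in
      different summands.\<close>
    then have "0 < min (d (Inr x) (Inl \<gamma>)) (inverse (real (Suc (Suc n))))"
      by (auto simp: mdist_pos_less)
    from ex[OF this] show "\<exists>\<gamma>'. (\<gamma>' \<in> \<Gamma> \<and> \<not> P \<gamma>' \<and> d (Inr x) (Inl \<gamma>') < inverse (real (Suc (Suc n)))) \<and>
        d (Inr x) (Inl \<gamma>') < d (Inr x) (Inl \<gamma>)"
      by auto
  qed (use ex[of 1] in auto)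
  then obtain g where g: "\<And>n. g n \<in> \<Gamma>" "\<And>n. \<not> P (g n)"
      "\<And>n. d (Inr x) (Inl (g n)) < inverse (real (Suc n))"
    and dec: "\<And>n. d (Inr x) (Inl (g (Suc n))) < d (Inr x) (Inl (g n))"
    by metis
  have "inj g"
  proof (rule linorder_injI)
    fix m n :: nat assume "m < n"
    then have "d (Inr x) (Inl (g n)) < d (Inr x) (Inl (g m))"
      using lift_Suc_mono_less[of "\<lambda>n. - d (Inr x) (Inl (g n))" m n] dec by simp
    then show "g m \<noteq> g n" by auto
  qed
  moreover have "limitin mtopology (\<lambda>n. Inl (g n)) (Inr x) sequentially"
    unfolding limitin_metric
  proof (intro conjI allI impI)
    fix e :: real assume "e > 0"
    then have "\<forall>\<^sub>F n in sequentially. inverse (real (Suc n)) < e"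
      using LIMSEQ_inverse_real_of_nat order_tendstoD(2) by blast
    then show "\<forall>\<^sub>F n in sequentially. Inl (g n) \<in> \<Gamma> <+> (UNIV :: 'm set) \<and> d (Inl (g n)) (Inr x) < e"
      by (rule eventually_mono) (use g in \<open>auto simp: commute intro: less_trans\<close>)
  qed simp
  ultimately show ?thesis using that g by blast
qed

text \<open>Along a subsequence of any counterexample both \<open>inv \<gamma>\<close> and
  \<open>inv \<gamma> \<circ> \<beta>\<close> tend to the same repelling point. With
  \<open>\<beta> = inv \<alpha>\<close> this compares the inverses of \<open>\<gamma>\<close> and
  \<open>\<alpha> \<circ> \<gamma>\<close>.\<close>

lemma eventually_inverses_close:
  assumes \<beta>: "\<beta> \<in> \<Gamma>" and e: "e > 0"
  shows "\<forall>\<^sub>F \<gamma> in group_elements_tending_to mtopology x. d (Inl (inv \<gamma>)) (Inl (inv \<gamma> \<circ> \<beta>)) < e"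
proof (rule ccontr)
  assume "\<not> ?thesis"
  then obtain g where g: "range g \<subseteq> \<Gamma>" "inj g"
    and far: "\<And>n :: nat. \<not> d (Inl (inv (g n))) (Inl (inv (g n) \<circ> \<beta>)) < e"
    and lim: "limitin mtopology (\<lambda>n. Inl (g n)) (Inr x) sequentially"
    by (rule not_eventually_tending_to_obtains_seq) blast
  from convergence_subsequence[OF g lim]
  obtain r y where r: "\<And>\<beta>. \<beta> \<in> \<Gamma> \<Longrightarrow>
      limitin mtopology (\<lambda>n. Inl (inv (g ((r :: nat \<Rightarrow> nat) n)) \<circ> \<beta>)) (Inr y) sequentially"
    by blast
  have "\<forall>\<^sub>F n in sequentially. Inl (inv (g (r n)) \<circ> \<gamma>) \<in> \<Gamma> <+> (UNIV :: 'm set) \<and>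
      d (Inl (inv (g (r n)) \<circ> \<gamma>)) (Inr y) < e / 2" if "\<gamma> \<in> \<Gamma>" for \<gamma>
    using r[OF that, unfolded limitin_metric, THEN conjunct2, rule_format, OF half_gt_zero[OF e]] .
  from eventually_happens'[OF sequentially_bot eventually_conj[OF this[OF id_mem] this[OF \<beta>]]]
  obtain n where n: "Inl (inv (g (r n))) \<in> \<Gamma> <+> (UNIV :: 'm set)" "Inl (inv (g (r n)) \<circ> \<beta>) \<in> \<Gamma> <+> (UNIV :: 'm set)"
      "d (Inl (inv (g (r n)))) (Inr y) < e / 2" "d (Inl (inv (g (r n)) \<circ> \<beta>)) (Inr y) < e / 2"
    by auto
  have "d (Inl (inv (g (r n)))) (Inl (inv (g (r n)) \<circ> \<beta>)) < e"
    using triangle'[OF n(1) in_union_iff(2)[of y] n(2)] n(3,4) by simp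
  with far show False by blast
qed

text \<open>In a counterexample the inverses subconverge to the repelling point \<open>y\<close>, so
  the distance condition forces \<open>z \<noteq> y\<close>, and \<open>z\<close> is then attracted
  to \<open>x\<close>.\<close>

lemma eventually_attracted:
  assumes V: "open V" "x \<in> V" and e: "e > 0"
  shows "\<forall>\<^sub>F \<gamma> in group_elements_tending_to mtopology x.
    d (Inr z) (Inl (inv \<gamma>)) > e \<longrightarrow> \<gamma> z \<in> V"
proof (rule ccontr)
  assume "\<not> ?thesis"
  then obtain g where g: "range g \<subseteq> \<Gamma>" "inj g"
    and far: "\<And>n :: nat. d (Inr z) (Inl (inv (g n))) > e" "\<And>n. g n z \<notin> V"
    and lim: "limitin mtopology (\<lambda>n. Inl (g n)) (Inr x) sequentially"
    by (rule not_eventually_tending_to_obtains_seq) blast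
  from convergence_subsequence[OF g lim]
  obtain r y where
    lu: "locally_uniformly_to_const mtopology
      (\<lambda>n. compactification_action (g ((r :: nat \<Rightarrow> nat) n))) (Inr y) (Inr x)"
    and r: "\<And>\<beta>. \<beta> \<in> \<Gamma> \<Longrightarrow> limitin mtopology (\<lambda>n. Inl (inv (g (r n)) \<circ> \<beta>)) (Inr y) sequentially"
    by blast
  have "\<forall>\<^sub>F n in sequentially. d (Inl (inv (g (r n)))) (Inr y) < e"
    using r[OF id_mem] e unfolding limitin_metric by (auto elim: eventually_mono)
  then obtain n where "d (Inl (inv (g (r n)))) (Inr y) < e"
    by (auto dest!: eventually_happens)
  then have "z \<noteq> y"
    using far(1)[of "r n"] commute[of "Inr y"] by auto
  obtain U where U: "openin mtopology U" "Inr x \<in> U" "\<And>z. Inr z \<in> U \<Longrightarrow> z \<in> V"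
    using Inr_nhd[OF V] by blast
  have "\<forall>\<^sub>F n in sequentially. compactification_action (g (r n)) ` {Inr z} \<subseteq> U"
    using U \<open>z \<noteq> y\<close> by (intro locally_uniformly_to_const_compactin[OF lu]) auto
  then obtain n where "Inr (g (r n) z) \<in> U"
    by (auto dest!: eventually_happens simp: compactification_action_def)
  then show False using U far(2) by blast
qed

lemma eventually_mem: "\<forall>\<^sub>F \<gamma> in group_elements_tending_to mtopology x. \<gamma> \<in> \<Gamma>"
proof (rule ccontr)
  assume "\<not> ?thesis"
  then obtain g where "range g \<subseteq> \<Gamma>" "\<And>n :: nat. g n \<notin> \<Gamma>"
    by (rule not_eventually_tending_to_obtains_seq) blast
  then show False by auto
qed

section \<open>Weights and the interpolated magnitude\<close>

definition radius :: real where
  "radius = d (Inr z1) (Inr z2) / 3"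

text \<open>A ramp in the distance from \<open>z1\<close>: 0 up to \<open>radius\<close>, 1 from
  \<open>2 * radius\<close> on. As \<open>z2\<close> is at distance \<open>3 * radius\<close> from
  \<open>z1\<close>, the weight is 1 on the ball of radius \<open>radius\<close> about
  \<open>z2\<close>.\<close>

definition weight :: "('m \<Rightarrow> 'm) + 'm \<Rightarrow> real" where
  "weight p = max 0 (min 1 ((d (Inr z1) p - radius) / radius))"

definition interpolated_magnitude :: "(('m \<Rightarrow> 'm) \<Rightarrow> 'm \<Rightarrow> real) \<Rightarrow> ('m \<Rightarrow> 'm) \<Rightarrow> real" where
  "interpolated_magnitude \<sigma> \<gamma> =
     weight (Inl (inv \<gamma>)) * \<sigma> \<gamma> z1 + (1 - weight (Inl (inv \<gamma>))) * \<sigma> \<gamma> z2"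

lemma radius_pos: "radius > 0"
  using z1_neq_z2 by (auto simp: radius_def mdist_pos_less)

lemma weight_bounds: "0 \<le> weight p" "weight p \<le> 1"
  by (auto simp: weight_def)

lemma weight_nonzero: "weight p \<noteq> 0 \<Longrightarrow> d (Inr z1) p > radius"
  using radius_pos by (auto simp: weight_def max_def min_def field_simps split: if_splits)

lemma weight_neq_one:
  assumes "weight p \<noteq> 1" "p \<in> \<Gamma> <+> UNIV"
  shows "d (Inr z2) p > radius"
proof -
  have "d (Inr z1) p < 2 * radius"
    using radius_pos assms(1) by (auto simp: weight_def max_def min_def field_simps split: if_splits)
  moreover have "3 * radius \<le> d (Inr z1) p + d (Inr z2) p"
    using triangle''[of "Inr z1" "Inr z2" p] triangle[of "Inr z1" p "Inr z2"] assms(2)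
    by (simp add: radius_def commute)
  ultimately show ?thesis by simp
qed

text \<open>The distance from \<open>z1\<close> is 1-Lipschitz, and clamping to the unit interval
  does not increase differences.\<close>

lemma weight_lipschitz:
  assumes "p \<in> \<Gamma> <+> UNIV" "q \<in> \<Gamma> <+> UNIV"
  shows "\<bar>weight p - weight q\<bar> \<le> d p q / radius"
proof -
  have "\<bar>d (Inr z1) p - d (Inr z1) q\<bar> \<le> d p q"
    using triangle[of "Inr z1" p q] triangle[of "Inr z1" q p] assms by (simp add: commute)
  then have "\<bar>(d (Inr z1) p - radius) / radius - (d (Inr z1) q - radius) / radius\<bar> \<le> d p q / radius"
    using radius_pos by (simp add: diff_divide_distrib[symmetric] divide_right_mono)
  then show ?thesis
    unfolding weight_def by linarith
qed

text \<open>The bounds are conditional because a base point close to the inverse has weight 0, and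
  no estimate is available there.\<close>

lemma weighted_abs_le:
  assumes "0 \<le> w" "w \<le> 1" "w \<noteq> 0 \<Longrightarrow> \<bar>a\<bar> \<le> c" "w \<noteq> 1 \<Longrightarrow> \<bar>b\<bar> \<le> c"
  shows "\<bar>w * a + (1 - w) * b\<bar> \<le> (c :: real)"
proof -
  have "\<bar>w * a\<bar> \<le> w * c" "\<bar>(1 - w) * b\<bar> \<le> (1 - w) * c"
    using assms by (cases "w = 0"; cases "w = 1"; simp add: abs_mult mult_left_mono)+
  then have "\<bar>w * a + (1 - w) * b\<bar> \<le> w * c + (1 - w) * c" by linarith
  then show ?thesis by (simp add: algebra_simps)
qed

text \<open>A function at bounded distance from a magnitude is a magnitude. Here the bound is the
  constant of \<open>mag\<close> at the scale \<open>radius\<close>, since a base point with nonzero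
  weight is farther than \<open>radius\<close> from the inverse.\<close>

lemma is_magnitude_interpolated:
  assumes "is_magnitude \<Gamma> d \<sigma> mag"
  shows "is_magnitude \<Gamma> d \<sigma> (interpolated_magnitude \<sigma>)"
  unfolding is_magnitude_def
proof (intro allI impI)
  have ex: "\<exists>C>0. \<forall>x. \<forall>\<gamma>\<in>\<Gamma>. d (Inr x) (Inl (inv \<gamma>)) > e \<longrightarrow> \<bar>\<sigma> \<gamma> x - mag \<gamma>\<bar> \<le> C"
    if "e > 0" for e
    using assms that unfolding is_magnitude_def abs_le_iff by (smt (verit))
  fix e :: real assume "e > 0"
  from ex[OF this] obtain C where C: "C > 0"
    "\<And>x \<gamma>. \<gamma> \<in> \<Gamma> \<Longrightarrow> d (Inr x) (Inl (inv \<gamma>)) > e \<Longrightarrow> \<bar>\<sigma> \<gamma> x - mag \<gamma>\<bar> \<le> C" by blast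
  from ex[OF radius_pos] obtain D where D: "D > 0"
    "\<And>x \<gamma>. \<gamma> \<in> \<Gamma> \<Longrightarrow> d (Inr x) (Inl (inv \<gamma>)) > radius \<Longrightarrow> \<bar>\<sigma> \<gamma> x - mag \<gamma>\<bar> \<le> D" by blast
  have near: "\<bar>interpolated_magnitude \<sigma> \<gamma> - mag \<gamma>\<bar> \<le> D" if "\<gamma> \<in> \<Gamma>" for \<gamma>
  proof -
    let ?w = "weight (Inl (inv \<gamma>))"
    have "interpolated_magnitude \<sigma> \<gamma> - mag \<gamma>
        = ?w * (\<sigma> \<gamma> z1 - mag \<gamma>) + (1 - ?w) * (\<sigma> \<gamma> z2 - mag \<gamma>)"
      by (simp add: interpolated_magnitude_def algebra_simps)
    also have "\<bar>\<dots>\<bar> \<le> D"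
      using that D(2) weight_nonzero weight_neq_one inv_mem
      by (intro weighted_abs_le weight_bounds) auto
    finally show ?thesis .
  qed
  show "\<exists>C>0. \<forall>x. \<forall>\<gamma>\<in>\<Gamma>. d (Inr x) (Inl (inv \<gamma>)) > e \<longrightarrow>
      interpolated_magnitude \<sigma> \<gamma> - C \<le> \<sigma> \<gamma> x \<and> \<sigma> \<gamma> x \<le> interpolated_magnitude \<sigma> \<gamma> + C"
  proof (intro exI[of _ "C + D"] conjI allI ballI impI)
    fix x \<gamma> assume "\<gamma> \<in> \<Gamma>" "d (Inr x) (Inl (inv \<gamma>)) > e"
    with near[of \<gamma>] C(2)[of \<gamma> x]
    show "interpolated_magnitude \<sigma> \<gamma> - (C + D) \<le> \<sigma> \<gamma> x"
      "\<sigma> \<gamma> x \<le> interpolated_magnitude \<sigma> \<gamma> + (C + D)" by linarith+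
  qed (use C D in simp)
qed

text \<open>One \<open>\<kappa>\<close> comes from the cocycle identity, the other from coarse
  continuity at \<open>x\<close>. Half of \<open>e\<close> pays for the continuity estimate, half
  for the change of weights.\<close>

lemma interpolated_magnitude_difference:
  assumes "coarse_cocycle \<kappa> \<Gamma> \<sigma>" "is_magnitude \<Gamma> d \<sigma> mag" "\<alpha> \<in> \<Gamma>" "e > 0"
  shows "\<forall>\<^sub>F \<gamma> in group_elements_tending_to mtopology x.
    \<bar>\<sigma> \<alpha> x - (interpolated_magnitude \<sigma> (\<alpha> \<circ> \<gamma>) - interpolated_magnitude \<sigma> \<gamma>)\<bar> < 2 * \<kappa> + e"
proof -
  have \<kappa>: "\<kappa> \<ge> 0"
    and limsup: "Limsup (at x) (\<lambda>y. ereal \<bar>\<sigma> \<alpha> x - \<sigma> \<alpha> y\<bar>) \<le> ereal \<kappa>"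
    and cocycle: "\<And>\<gamma> z. \<gamma> \<in> \<Gamma> \<Longrightarrow> \<bar>\<sigma> (\<alpha> \<circ> \<gamma>) z - (\<sigma> \<alpha> (\<gamma> z) + \<sigma> \<gamma> z)\<bar> \<le> \<kappa>"
    using assms unfolding coarse_cocycle_def by auto
  have "\<forall>\<^sub>F y in at x. ereal \<bar>\<sigma> \<alpha> x - \<sigma> \<alpha> y\<bar> < ereal (\<kappa> + e / 2)"
    using limsup assms(4) unfolding Limsup_le_iff
    by (metis ereal_less_eq(3) half_gt_zero less_add_same_cancel1 not_le)
  \<comment> \<open>The filter \<open>at x\<close> omits \<open>x\<close>, but there the difference
    is 0, which is below the bound.\<close>
  then obtain V where V: "open V" "x \<in> V" "\<And>y. y \<in> V \<Longrightarrow> \<bar>\<sigma> \<alpha> x - \<sigma> \<alpha> y\<bar> < \<kappa> + e / 2"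
    unfolding eventually_at_topological using \<kappa> assms(4) by (metis (no_types, lifting)
      UNIV_I abs_zero add_nonneg_pos cancel_comm_monoid_add_class.diff_cancel half_gt_zero less_ereal.simps(1))
  \<comment> \<open>Half the scale leaves room for passing from \<open>inv \<gamma>\<close> to the
    nearby inverse of \<open>\<alpha> \<circ> \<gamma>\<close>.\<close>
  let ?r = "radius / 2"
  have "?r > 0" using radius_pos by simp
  then obtain C where C: "C > 0"
    "\<And>z \<gamma>. \<gamma> \<in> \<Gamma> \<Longrightarrow> d (Inr z) (Inl (inv \<gamma>)) > ?r \<Longrightarrow> mag \<gamma> - C \<le> \<sigma> \<gamma> z \<and> \<sigma> \<gamma> z \<le> mag \<gamma> + C"
    using assms(2) unfolding is_magnitude_def by blast
  \<comment> \<open>Divided by \<open>radius\<close>, the second bound limits the change of weights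
    to \<open>e / (4 * C)\<close>; it multiplies a difference of at most \<open>2 * C\<close>,
    giving \<open>e / 2\<close>.\<close>
  define \<delta> where "\<delta> = min ?r (radius * e / (4 * C))"
  have \<delta>: "\<delta> > 0" using radius_pos C assms(4) by (simp add: \<delta>_def)
  have attracted: "\<forall>\<^sub>F \<gamma> in group_elements_tending_to mtopology x.
      d (Inr z) (Inl (inv \<gamma>)) > radius \<longrightarrow> \<gamma> z \<in> V" for z
    using V radius_pos by (intro eventually_attracted)
  show ?thesis
    using eventually_mem eventually_inverses_close[OF inv_mem[OF assms(3)] \<delta>]
      attracted[of z1] attracted[of z2]
  proof eventually_elim
    case (elim \<gamma>)
    define p where "p = (Inl (inv \<gamma>) :: ('m \<Rightarrow> 'm) + 'm)"
    define q where "q = (Inl (inv (\<alpha> \<circ> \<gamma>)) :: ('m \<Rightarrow> 'm) + 'm)"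
    note \<gamma> = \<open>\<gamma> \<in> \<Gamma>\<close>
    have pq: "p \<in> \<Gamma> <+> UNIV" "q \<in> \<Gamma> <+> UNIV"
      using \<gamma> assms(3) by (auto simp: p_def q_def inv_mem comp_mem)
    have dpq: "d p q < \<delta>"
      using elim(2) by (simp add: p_def q_def inv_comp[OF assms(3) \<gamma>])
    let ?f = "\<lambda>z. \<sigma> (\<alpha> \<circ> \<gamma>) z"
    have f: "\<bar>?f z - \<sigma> \<gamma> z - \<sigma> \<alpha> x\<bar> \<le> 2 * \<kappa> + e / 2" if "\<gamma> z \<in> V" for z
      using cocycle[OF \<gamma>, of z] V(3)[OF that] by linarith
    have main: "\<bar>weight p * (?f z1 - \<sigma> \<gamma> z1 - \<sigma> \<alpha> x) + (1 - weight p) * (?f z2 - \<sigma> \<gamma> z2 - \<sigma> \<alpha> x)\<bar>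
        \<le> 2 * \<kappa> + e / 2"
      using elim(3,4) weight_nonzero[of p] weight_neq_one[OF _ pq(1)]
      by (intro weighted_abs_le weight_bounds f) (auto simp: p_def)
    have error: "\<bar>(weight q - weight p) * (?f z1 - ?f z2)\<bar> < e / 2"
    proof (cases "weight q = weight p")
      case False
      have far: "d (Inr z) q > ?r" if "d (Inr z) p > radius \<or> d (Inr z) q > radius" for z
        using that dpq triangle[of "Inr z" q p] pq radius_pos by (auto simp: \<delta>_def commute)
      \<comment> \<open>Unequal weights cannot both be 0 or both be 1, so each base point is far
        from \<open>p\<close> or from \<open>q\<close>, hence in either case from
        \<open>q\<close>.\<close>
      have "weight p \<noteq> 0 \<or> weight q \<noteq> 0" "weight p \<noteq> 1 \<or> weight q \<noteq> 1"
        using False by auto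
      then have "d (Inr z1) q > ?r" "d (Inr z2) q > ?r"
        using weight_nonzero weight_neq_one pq far by blast+
      then have "\<bar>?f z1 - ?f z2\<bar> \<le> 2 * C"
        using C(2)[of "\<alpha> \<circ> \<gamma>" z1] C(2)[of "\<alpha> \<circ> \<gamma>" z2] comp_mem[OF assms(3) \<gamma>]
        unfolding q_def by linarith
      moreover have "\<bar>weight q - weight p\<bar> < e / (4 * C)"
      proof -
        have "\<bar>weight q - weight p\<bar> \<le> d p q / radius"
          using weight_lipschitz[OF pq] by linarith
        also have "\<dots> < \<delta> / radius"
          using dpq radius_pos by (simp add: divide_strict_right_mono)
        also have "\<dots> \<le> (radius * e / (4 * C)) / radius"
          using radius_pos by (intro divide_right_mono) (auto simp: \<delta>_def)
        finally show ?thesis using radius_pos by simp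
      qed
      ultimately have "\<bar>weight q - weight p\<bar> * \<bar>?f z1 - ?f z2\<bar> < e / (4 * C) * (2 * C)"
        using C(1) by (smt (verit) abs_ge_zero mult_left_mono mult_strict_right_mono)
      then show ?thesis using C(1) by (simp add: abs_mult)
    qed (use assms(4) in simp)
    \<comment> \<open>Both magnitudes are expressed with the weights at \<open>p\<close>. As weights
      sum to 1, the correction involves only the difference of \<open>?f\<close> at the base
      points.\<close>
    have "interpolated_magnitude \<sigma> (\<alpha> \<circ> \<gamma>) - interpolated_magnitude \<sigma> \<gamma> - \<sigma> \<alpha> x
      = weight p * (?f z1 - \<sigma> \<gamma> z1 - \<sigma> \<alpha> x) + (1 - weight p) * (?f z2 - \<sigma> \<gamma> z2 - \<sigma> \<alpha> x)
        + (weight q - weight p) * (?f z1 - ?f z2)"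
      by (simp add: interpolated_magnitude_def p_def q_def algebra_simps)
    then show ?case using main error by linarith
  qed
qed

end

section \<open>Passage to the limit superior\<close>

theorem lemma1p14:
  fixes \<Gamma> :: "('m::topological_space \<Rightarrow> 'm) set"
    and T :: "(('m \<Rightarrow> 'm) + 'm) topology"
    and d :: "('m \<Rightarrow> 'm) + 'm \<Rightarrow> ('m \<Rightarrow> 'm) + 'm \<Rightarrow> real"
    and \<sigma> :: "('m \<Rightarrow> 'm) \<Rightarrow> 'm \<Rightarrow> real"
    and \<kappa> :: real
  assumes "compact (UNIV :: 'm set)"
    and "metrizable_space (euclidean :: 'm topology)"
    and "convergence_group \<Gamma>"
    and "non_elementary \<Gamma>"
    and "compactification_topology \<Gamma> T"
    and "compatible_metric \<Gamma> T d"
    and "coarse_cocycle \<kappa> \<Gamma> \<sigma>"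
    and "expanding \<Gamma> d \<sigma>"
  shows "\<exists>mag. is_magnitude \<Gamma> d \<sigma> mag \<and>
           (\<forall>x\<in>limit_set \<Gamma>. \<forall>\<alpha>\<in>\<Gamma>.
              Limsup (group_elements_tending_to T x)
                (\<lambda>\<gamma>. ereal \<bar>\<sigma> \<alpha> x - (mag (\<alpha> \<circ> \<gamma>) - mag \<gamma>)\<bar>) \<le> ereal (2 * \<kappa>))"
proof -
  \<comment> \<open>A limit set with at least three points contains a point other than any given
    \<open>z\<close>, which provides distinct base points.\<close>
  have "\<not> limit_set \<Gamma> \<subseteq> {z}" for z
    using assms(4) card_mono[of "{z}" "limit_set \<Gamma>"] finite_subset[of "limit_set \<Gamma>" "{z}"]
    by (auto simp: non_elementary_def)
  then obtain z1 z2 :: 'm where "z1 \<noteq> z2" by blast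
  then interpret group_compactification \<Gamma> d z1 z2
    using assms by (auto simp: group_compactification_def group_compactification_axioms_def
        compatible_metric_def convergence_group_def)
  have T: "mtopology = T" using assms(6) by (simp add: compatible_metric_def)
  obtain mag where mag: "is_magnitude \<Gamma> d \<sigma> mag"
    using assms(8) by (auto simp: expanding_def)
  show ?thesis
  proof (intro exI[of _ "interpolated_magnitude \<sigma>"] conjI ballI)
    show "is_magnitude \<Gamma> d \<sigma> (interpolated_magnitude \<sigma>)"
      using mag by (rule is_magnitude_interpolated)
  next
    fix x \<alpha> assume "\<alpha> \<in> \<Gamma>"
    let ?F = "group_elements_tending_to T x"
    let ?h = "\<lambda>\<gamma>. \<bar>\<sigma> \<alpha> x - (interpolated_magnitude \<sigma> (\<alpha> \<circ> \<gamma>) - interpolated_magnitude \<sigma> \<gamma>)\<bar>"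
    show "Limsup ?F (\<lambda>\<gamma>. ereal (?h \<gamma>)) \<le> ereal (2 * \<kappa>)"
      unfolding Limsup_le_iff
    proof (intro allI impI)
      fix c assume "ereal (2 * \<kappa>) < c"
      \<comment> \<open>As \<open>c\<close> may be infinite, a real \<open>b\<close> in between
        supplies the error \<open>b - 2 * \<kappa>\<close>.\<close>
      then obtain b where b: "2 * \<kappa> < b" "ereal b < c"
        using ereal_dense2 by force
      have "\<forall>\<^sub>F \<gamma> in ?F. ?h \<gamma> < 2 * \<kappa> + (b - 2 * \<kappa>)"
        using interpolated_magnitude_difference[OF assms(7) mag \<open>\<alpha> \<in> \<Gamma>\<close>, of "b - 2 * \<kappa>" x] b T
        by simp
      then show "\<forall>\<^sub>F \<gamma> in ?F. ereal (?h \<gamma>) < c"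
        by (rule eventually_mono) (use b(2) in \<open>simp add: less_trans[of "ereal _" "ereal b" c]\<close>)
    qed
  qed
qed

end
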